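(* Let $\Bbbk$ be an algebraically closed field, $G$ a linear algebraic group over $\Bbbk$ and $V$ a $G$-module. Then $\delta(G,V)$ equals either $0$ or $1$ or is divisible by the characteristic of $\Bbbk$. In particular, if $\Bbbk$ is a field of characteristic zero, then $\delta(G)=1$.
   Context: A $G$-module is a finite-dimensional rational representation $V$ of $G$ over $\Bbbk$. $\Bbbk[V]\cong S(V^* )$ is the ring of polynomial functions on $V$, with $G$-action $(g\cdot f)(v)=f(g^{-1}v)$ and invariant ring $\Bbbk[V]^G$, graded by degree. $\Bbbk[V]^G_{\le d}$ is the set of invariants of degree at most $d$. For $S\subseteq \Bbbk[V]$, $S_+$ is the set of elements of $S$ with constant term zero. The nullcone $\mathcal{N}_{G,V}\subseteq V$ is the common zero set of $\Bbbk[V]^G_+$. A subset $S\subseteq\Bbbk[V]^G$ is a $\delta$-set if for every $v\in V^G\setminus\mathcal{N}_{G,V}$ there is $f\in S_+$ with $f(v)\neq 0$. Define $\delta(G,V)=\min\{d\ge 0 : \Bbbk[V]^G_{\le d}\text{ is a }\delta\text{-set}\}$ and $\delta(G)=\sup\{\delta(G,V): V\text{ a }G\text{-module}\}$ (equal to $\infty$ if unbounded). *)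

theory Defs
  imports
    "HOL-Computational_Algebra.Polynomial"
    "HOL-Algebra.Group"
    "HOL-Analysis.Finite_Cartesian_Product"
    "HOL-Library.Function_Algebras"
    "HOL-Library.Extended_Nat"
begin

definition fun_scale :: "'k \<Rightarrow> ('x \<Rightarrow> 'k) \<Rightarrow> 'x \<Rightarrow> 'k::field"
  where "fun_scale c f = (\<lambda>x. c * f x)"

interpretation fun_space: vector_space fun_scale
  by unfold_locales (auto simp: fun_scale_def fun_eq_iff algebra_simps)

text \<open>
  Polynomials in a set \<open>B\<close> of scalar functions. The field will be algebraically closed, hence
  infinite, so polynomial functions and polynomials are the same thing.
\<close>

definition polys_le :: "('x \<Rightarrow> 'k::field) set \<Rightarrow> nat \<Rightarrow> ('x \<Rightarrow> 'k) set"
  where "polys_le B d = fun_space.span {\<lambda>x. \<Prod>b\<leftarrow>bs. b x | bs. set bs \<subseteq> B \<and> length bs \<le> d}"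

definition polys :: "('x \<Rightarrow> 'k::field) set \<Rightarrow> ('x \<Rightarrow> 'k) set"
  where "polys B = (\<Union>d. polys_le B d)"

definition coords :: "('k ^ 'm \<Rightarrow> 'k) set"
  where "coords = range (\<lambda>i x. x $ i)"

definition zariski_closed :: "('k::field ^ 'm) set \<Rightarrow> bool"
  where "zariski_closed X \<longleftrightarrow> (\<exists>F \<subseteq> polys coords. X = {x. \<forall>f\<in>F. f x = 0})"

definition regular_on :: "('k::field ^ 'm) set \<Rightarrow> ('k ^ 'm \<Rightarrow> 'k) \<Rightarrow> bool"
  where "regular_on X f \<longleftrightarrow> (\<exists>p\<in>polys coords. \<forall>x\<in>X. f x = p x)"

text \<open>Regular functions on \<open>X \<times> X\<close>, a closed subset of \<open>k\<^sup>m \<times> k\<^sup>m\<close>.\<close>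

definition regular_on_square :: "('k::field ^ 'm) set \<Rightarrow> ('k ^ 'm \<Rightarrow> 'k ^ 'm \<Rightarrow> 'k) \<Rightarrow> bool"
  where "regular_on_square X f \<longleftrightarrow>
    (\<exists>p\<in>polys ((\<lambda>c. c \<circ> fst) ` coords \<union> (\<lambda>c. c \<circ> snd) ` coords). \<forall>x\<in>X. \<forall>y\<in>X. f x y = p (x, y))"

text \<open>
  An affine variety (possibly reducible) is identified with its set of points in an affine space
  \<open>k\<^sup>m\<close>. The multiplication of \<open>G\<close> is an arbitrary morphism; \<open>G\<close> need not be given as a group
  of matrices.
\<close>

locale linear_algebraic_group = group G
  for G :: "('k::alg_closed_field ^ 'm) monoid" (structure) +
  assumes closed: "zariski_closed (carrier G)"
    and regular_mult: "\<And>i. regular_on_square (carrier G) (\<lambda>x y. (x \<otimes>\<^bsub>G\<^esub> y) $ i)"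
    and regular_inv: "\<And>i. regular_on (carrier G) (\<lambda>x. (inv\<^bsub>G\<^esub> x) $ i)"

text \<open>
  The linear forms on a subspace \<open>V\<close>; their values outside \<open>V\<close> are arbitrary and are removed
  by \<open>restrict\<close> below.
\<close>

definition linear_forms :: "('k::field \<Rightarrow> 'v::ab_group_add \<Rightarrow> 'v) \<Rightarrow> 'v set \<Rightarrow> ('v \<Rightarrow> 'k) set"
  where "linear_forms smul V =
    {l. (\<forall>x\<in>V. \<forall>y\<in>V. l (x + y) = l x + l y) \<and> (\<forall>c. \<forall>x\<in>V. l (smul c x) = c * l x)}"

text \<open>
  A module is a finite-dimensional subspace \<open>V\<close> of some vector space, with a representation whose
  matrix coefficients are regular functions on \<open>G\<close>, that is, the homomorphism to \<open>GL(V)\<close> is a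
  morphism (the inverse determinant of \<open>g\<close> is the determinant of the inverse of \<open>g\<close>, hence regular).
\<close>

locale G_module = linear_algebraic_group G + vector_space smul
  for G :: "('k::alg_closed_field ^ 'm) monoid" (structure)
    and smul :: "'k \<Rightarrow> 'v::ab_group_add \<Rightarrow> 'v" +
  fixes V :: "'v set" and act :: "'k ^ 'm \<Rightarrow> 'v \<Rightarrow> 'v"
  assumes finite_dim: "\<exists>B. finite B \<and> V = span B"
    and act_closed: "\<And>g v. g \<in> carrier G \<Longrightarrow> v \<in> V \<Longrightarrow> act g v \<in> V"
    and act_add: "\<And>g v w. g \<in> carrier G \<Longrightarrow> v \<in> V \<Longrightarrow> w \<in> V \<Longrightarrow> act g (v + w) = act g v + act g w"
    and act_scale: "\<And>g c v. g \<in> carrier G \<Longrightarrow> v \<in> V \<Longrightarrow> act g (smul c v) = smul c (act g v)"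
    and act_one: "\<And>v. v \<in> V \<Longrightarrow> act \<one>\<^bsub>G\<^esub> v = v"
    and act_mult: "\<And>g h v. g \<in> carrier G \<Longrightarrow> h \<in> carrier G \<Longrightarrow> v \<in> V \<Longrightarrow>
      act (g \<otimes>\<^bsub>G\<^esub> h) v = act g (act h v)"
    and rational: "\<And>v l. v \<in> V \<Longrightarrow> l \<in> linear_forms smul V \<Longrightarrow> regular_on (carrier G) (\<lambda>g. l (act g v))"
begin

definition coord_ring_le :: "nat \<Rightarrow> ('v \<Rightarrow> 'k) set"
  where "coord_ring_le d = (\<lambda>f. restrict f V) ` polys_le (linear_forms smul V) d"

definition coord_ring :: "('v \<Rightarrow> 'k) set"
  where "coord_ring = (\<Union>d. coord_ring_le d)"

definition fun_act :: "'k ^ 'm \<Rightarrow> ('v \<Rightarrow> 'k) \<Rightarrow> 'v \<Rightarrow> 'k"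
  where "fun_act g f = (\<lambda>v\<in>V. f (act (inv\<^bsub>G\<^esub> g) v))"

definition invariants :: "('v \<Rightarrow> 'k) set"
  where "invariants = {f \<in> coord_ring. \<forall>g\<in>carrier G. fun_act g f = f}"

definition invariants_le :: "nat \<Rightarrow> ('v \<Rightarrow> 'k) set"
  where "invariants_le d = invariants \<inter> coord_ring_le d"

text \<open>The constant term of a polynomial function is its value at the origin.\<close>

definition plus_part :: "('v \<Rightarrow> 'k) set \<Rightarrow> ('v \<Rightarrow> 'k) set"
  where "plus_part S = {f \<in> S. f 0 = 0}"

definition nullcone :: "'v set"
  where "nullcone = {v \<in> V. \<forall>f \<in> plus_part invariants. f v = 0}"

definition fixed_points :: "'v set"
  where "fixed_points = {v \<in> V. \<forall>g\<in>carrier G. act g v = v}"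

definition delta_set :: "('v \<Rightarrow> 'k) set \<Rightarrow> bool"
  where "delta_set S \<longleftrightarrow>
    S \<subseteq> invariants \<and> (\<forall>v \<in> fixed_points - nullcone. \<exists>f \<in> plus_part S. f v \<noteq> 0)"

text \<open>
  The minimum is attained: the common zero sets in \<open>V\<close> of the members of \<open>plus_part (invariants_le d)\<close>
  form a descending chain of Zariski closed sets.
\<close>

definition delta :: nat
  where "delta = (LEAST d. delta_set (invariants_le d))"

end

text \<open>
  Every finite-dimensional vector space is isomorphic to a subspace of the space of all sequences,
  so the following supremum is over all modules of \<open>G\<close> up to isomorphism.
\<close>

definition delta_group :: "('k::alg_closed_field ^ 'm) monoid \<Rightarrow> enat"
  where "delta_group G =
    Sup {enat (G_module.delta G fun_scale V act) | (V :: (nat \<Rightarrow> 'k) set) act.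
           G_module G fun_scale V act}"

end

(*
  Let Z d be the set of fixed vectors at which all invariants of degree at most d without constant
  term vanish.  If w is a fixed vector and f an invariant of degree at most d + 1 with f 0 = 0, then
  f (x + w) - f x - f w and f (c x) - c^(d+1) f x are invariants in x of degree at most d without
  constant term, so they vanish on Z d.  Hence f is additive and homogeneous of degree d + 1 on Z d.
  By induction every Z d is a linear subspace, so the chain of the Z d stabilises by comparing
  dimensions, without Noetherianity.  If delta = d + 1, some such f has f v \<noteq> 0 at some v in Z d,
  and evaluating at (1 + t) v gives (1 + t)^(d+1) = 1 + t^(d+1) for all scalars t; for d > 0 the
  linear coefficient shows that d + 1 vanishes in the field.
*)

theory Submission
  imports Defs
begin

section \<open>Polynomial functions filtered by degree\<close>

lemma polys_le_prod: "set bs \<subseteq> B \<Longrightarrow> length bs \<le> d \<Longrightarrow> (\<lambda>x. \<Prod>b\<leftarrow>bs. b x) \<in> polys_le B d"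
  unfolding polys_le_def by (rule fun_space.span_base) blast

lemma polys_le_const: "(\<lambda>x. c) \<in> polys_le B d"
  using fun_space.span_scale[OF polys_le_prod[of "[]" B d, unfolded polys_le_def], of c]
  by (simp add: polys_le_def fun_scale_def)

lemma polys_le_add:
  assumes "f \<in> polys_le B d" "g \<in> polys_le B d"
  shows "(\<lambda>x. f x + g x) \<in> polys_le B d"
  using fun_space.span_add[OF assms[unfolded polys_le_def]] by (simp add: polys_le_def plus_fun_def)

lemma polys_le_scale:
  assumes "f \<in> polys_le B d"
  shows "(\<lambda>x. c * f x) \<in> polys_le B d"
  using fun_space.span_scale[OF assms[unfolded polys_le_def]] by (simp add: polys_le_def fun_scale_def)

lemma polys_le_mono: "d \<le> e \<Longrightarrow> polys_le B d \<subseteq> polys_le B e"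
  unfolding polys_le_def by (rule fun_space.span_mono) (blast intro: le_trans)

text \<open>Splits off one scaled monomial at a time, so that each later claim needs real work only
  for monomials.\<close>

lemma polys_le_induct [consumes 1, case_names zero step]:
  assumes "f \<in> polys_le B d"
    and "P (\<lambda>x. 0)"
    and "\<And>c bs g. set bs \<subseteq> B \<Longrightarrow> length bs \<le> d \<Longrightarrow> P g \<Longrightarrow> P (\<lambda>x. c * (\<Prod>b\<leftarrow>bs. b x) + g x)"
  shows "P f"
  using assms(1) unfolding polys_le_def
proof (induction rule: fun_space.span_induct_alt)
  case base
  show ?case
    using assms(2) by (simp add: zero_fun_def)
next
  case (step c x y)
  then obtain bs where bs: "set bs \<subseteq> B" "length bs \<le> d" "x = (\<lambda>x. \<Prod>b\<leftarrow>bs. b x)"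
    by blast
  have "fun_scale c x + y = (\<lambda>z. c * (\<Prod>b\<leftarrow>bs. b z) + y z)"
    by (simp add: bs fun_scale_def plus_fun_def)
  then show ?case
    using assms(3)[OF bs(1,2) step(2)] by simp
qed

lemma polys_le_0D: "f \<in> polys_le B 0 \<Longrightarrow> f x = f y"
  by (induction rule: polys_le_induct) auto

lemma polys_le_mult:
  assumes "l \<in> B" "f \<in> polys_le B d"
  shows "(\<lambda>x. l x * f x) \<in> polys_le B (Suc d)"
  using assms(2)
proof (induction rule: polys_le_induct)
  case zero
  show ?case
    using polys_le_const[of 0] by simp
next
  case (step c bs g)
  have "(\<lambda>x. c * (\<Prod>b\<leftarrow>l # bs. b x) + l x * g x) \<in> polys_le B (Suc d)"
    using step assms(1) by (intro polys_le_add polys_le_scale polys_le_prod) auto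
  then show ?case
    by (simp add: algebra_simps)
qed

section \<open>Top-degree behaviour under translation and dilation\<close>

text \<open>Multiplying out the factors \<open>b x + b w\<close>, every term except the leading
  product loses at least one factor \<open>b x\<close>. The identity is limited to \<open>V\<close>,
  since the forms are linear only there.\<close>

lemma linear_prod_shift:
  assumes "set bs \<subseteq> linear_forms smul V" "length bs \<le> Suc d" "w \<in> V"
  shows "\<exists>h\<in>polys_le (linear_forms smul V) d.
    \<forall>x\<in>V. (\<Prod>b\<leftarrow>bs. b (x + w)) = (\<Prod>b\<leftarrow>bs. b x) + h x"
  using assms(1,2)
proof (induction bs arbitrary: d)
  case Nil
  then show ?case
    using polys_le_const[of 0] by force
next
  case (Cons l bs)
  let ?L = "linear_forms smul V"
  have l: "\<And>x. x \<in> V \<Longrightarrow> l (x + w) = l x + l w"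
    using Cons.prems assms(3) by (auto simp: linear_forms_def)
  show ?case
  proof (cases d)
    case 0
    then have "bs = []" using Cons.prems by simp
    then show ?thesis
      using l polys_le_const[of "l w" ?L d] by force
  next
    case (Suc m)
    then obtain h where h: "h \<in> polys_le ?L m"
      "\<And>x. x \<in> V \<Longrightarrow> (\<Prod>b\<leftarrow>bs. b (x + w)) = (\<Prod>b\<leftarrow>bs. b x) + h x"
      using Cons.IH[of m] Cons.prems by auto
    \<comment> \<open>This is \<open>(l x + l w) * (P x + h x) - l x * P x\<close> with
      \<open>P\<close> the product over \<open>bs\<close>. Since \<open>h\<close> has degree at most
      \<open>m\<close> and \<open>P\<close> at most \<open>d = Suc m\<close>, no term exceeds degree
      \<open>d\<close>.\<close>
    let ?h = "\<lambda>x. l x * h x + l w * ((\<Prod>b\<leftarrow>bs. b x) + h x)"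
    have "?h \<in> polys_le ?L d"
      using h(1) Cons.prems polys_le_mono[of m d ?L] Suc
      by (intro polys_le_add polys_le_scale polys_le_prod) (auto intro: polys_le_mult)
    moreover have "\<forall>x\<in>V. (\<Prod>b\<leftarrow>l # bs. b (x + w)) = (\<Prod>b\<leftarrow>l # bs. b x) + ?h x"
      using l h(2) by (simp add: algebra_simps)
    ultimately show ?thesis by (intro bexI[of _ ?h])
  qed
qed

lemma polys_le_shift:
  assumes "f \<in> polys_le (linear_forms smul V) (Suc d)" "w \<in> V"
  shows "\<exists>h\<in>polys_le (linear_forms smul V) d. \<forall>x\<in>V. f (x + w) = f x + h x"
  using assms(1)
proof (induction rule: polys_le_induct)
  case zero
  then show ?case
    using polys_le_const[of 0] by force
next
  case (step c bs g)
  let ?L = "linear_forms smul V"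
  obtain h where h: "h \<in> polys_le ?L d"
    "\<And>x. x \<in> V \<Longrightarrow> (\<Prod>b\<leftarrow>bs. b (x + w)) = (\<Prod>b\<leftarrow>bs. b x) + h x"
    using linear_prod_shift[OF step(1,2) assms(2)] by blast
  obtain k where k: "k \<in> polys_le ?L d" "\<And>x. x \<in> V \<Longrightarrow> g (x + w) = g x + k x"
    using step(3) by blast
  show ?case
    by (rule bexI[of _ "\<lambda>x. c * h x + k x"])
      (use h k in \<open>auto intro!: polys_le_add polys_le_scale simp: algebra_simps\<close>)
qed

lemma linear_prod_scale:
  assumes "set bs \<subseteq> linear_forms smul V" "x \<in> V"
  shows "(\<Prod>b\<leftarrow>bs. b (smul c x)) = c ^ length bs * (\<Prod>b\<leftarrow>bs. b x)"
  using assms by (induction bs) (auto simp: linear_forms_def algebra_simps)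

text \<open>A monomial of degree \<open>k\<close> is multiplied by \<open>c ^ k\<close>, so
  subtracting \<open>c ^ Suc d * f x\<close> cancels the top degree.\<close>

lemma polys_le_dilate:
  assumes "f \<in> polys_le (linear_forms smul V) (Suc d)"
  shows "\<exists>h\<in>polys_le (linear_forms smul V) d. \<forall>x\<in>V. f (smul c x) = c ^ Suc d * f x + h x"
  using assms
proof (induction rule: polys_le_induct)
  case zero
  then show ?case
    using polys_le_const[of 0] by force
next
  case (step a bs g)
  let ?L = "linear_forms smul V"
  \<comment> \<open>For \<open>length bs = Suc d\<close> the difference of powers is zero anyway;
    writing \<open>0\<close> makes \<open>?h\<close> the zero polynomial although \<open>bs\<close>
    is too long for degree \<open>d\<close>.\<close>
  let ?h = "\<lambda>x. (if length bs = Suc d then 0 else c ^ length bs - c ^ Suc d) * (\<Prod>b\<leftarrow>bs. b x)"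
  have h: "?h \<in> polys_le ?L d"
  proof (cases "length bs = Suc d")
    case True
    then show ?thesis using polys_le_const[of 0] by simp
  next
    case False
    then show ?thesis
      using step by (intro polys_le_scale polys_le_prod) auto
  qed
  obtain k where k: "k \<in> polys_le ?L d" "\<And>x. x \<in> V \<Longrightarrow> g (smul c x) = c ^ Suc d * g x + k x"
    using step(3) by blast
  show ?case
  proof (rule bexI[of _ "\<lambda>x. a * ?h x + k x"])
    show "\<forall>x\<in>V. a * (\<Prod>b\<leftarrow>bs. b (smul c x)) + g (smul c x)
      = c ^ Suc d * (a * (\<Prod>b\<leftarrow>bs. b x) + g x) + (a * ?h x + k x)"
      using k(2) linear_prod_scale[OF step(1), of _ c]
      by (cases "length bs = Suc d") (simp_all add: algebra_simps)
  qed (rule polys_le_add[OF polys_le_scale[OF h] k(1)])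
qed

section \<open>Two facts on fields and vector spaces\<close>

text \<open>An identity valid for all scalars is one of polynomials. The linear coefficient of
  \<open>(1 + X) ^ d\<close> is \<open>d\<close>, and \<open>d \<ge> 2\<close> keeps
  \<open>X ^ d\<close> from contributing to it.\<close>

lemma CHAR_dvd_if_additive_power:
  assumes "\<And>t::'k::alg_closed_field. (1 + t) ^ d = 1 + t ^ d" "d \<ge> 2"
  shows "CHAR('k) dvd d"
proof -
  define p :: "'k poly" where "p = [:1, 1:] ^ d - 1 - monom 1 d"
  \<comment> \<open>Since \<open>p\<close> takes only the value 0, \<open>p + 1\<close> has no root,
    and over an algebraically closed field it must be constant.\<close>
  have "degree (p + 1) = 0"
  proof (rule ccontr)
    assume "degree (p + 1) \<noteq> 0"
    then obtain t where "poly (p + 1) t = 0"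
      using alg_closed_imp_poly_has_root by blast
    then show False
      using assms(1)[of t] by (simp add: p_def poly_monom)
  qed
  then have "coeff (p + 1) 1 = 0"
    by (intro coeff_eq_0) simp
  then have "coeff ([:1, 1:] ^ d :: 'k poly) 1 = 0"
    using assms(2) by (simp add: p_def)
  then have "of_nat d = (0::'k)"
    using coeff_linear_poly_power[of 1 d "1::'k" 1] assms(2) by simp
  then show ?thesis
    by (simp add: of_nat_eq_0_iff_char_dvd)
qed

text \<open>The chain is constant from any index whose basis \<open>C n\<close> has least
  cardinality: if a later member missed some \<open>z\<close> of \<open>Z n\<close>, adding
  \<open>z\<close> to its basis would give an independent set in \<open>span (C n)\<close> with more
  elements than \<open>C n\<close>.\<close>

lemma (in vector_space) descending_subspaces_stabilise:
  fixes Z :: "nat \<Rightarrow> 'b set"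
  assumes "finite B" "\<And>n. Z n \<subseteq> span B" "\<And>n. subspace (Z n)" "antimono Z"
  shows "\<exists>n. \<forall>m\<ge>n. Z m = Z n"
proof -
  have "\<exists>C. C \<subseteq> Z n \<and> independent C \<and> Z n \<subseteq> span C" for n
    by (rule maximal_independent_subset[of "Z n"]) blast
  then obtain C where C: "C n \<subseteq> Z n" "independent (C n)" "Z n \<subseteq> span (C n)" for n
    by metis
  have fin: "finite (C n)" for n
    using independent_span_bound[OF assms(1) C(2)] C(1) assms(2) by blast
  obtain n where n: "\<And>m. card (C n) \<le> card (C m)"
    using ex_has_least_nat[of "\<lambda>_. True" undefined "\<lambda>n. card (C n)"] by auto
  have "Z m = Z n" if "n \<le> m" for m
  proof
    show "Z m \<subseteq> Z n"
      using assms(4) that by (simp add: antimonoD)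
    show "Z n \<subseteq> Z m"
    proof (rule ccontr)
      assume "\<not> Z n \<subseteq> Z m"
      then obtain z where z: "z \<in> Z n" "z \<notin> Z m" by blast
      have "span (C m) \<subseteq> Z m"
        using C(1) assms(3) by (rule span_minimal)
      then have z': "z \<notin> span (C m)"
        using z by blast
      then have ind: "independent (insert z (C m))"
        using C(2) by (simp add: independent_insert)
      have "insert z (C m) \<subseteq> span (C n)"
        using z C(1)[of m] \<open>Z m \<subseteq> Z n\<close> C(3)[of n] by blast
      then have "card (insert z (C m)) \<le> card (C n)"
        using independent_span_bound[OF fin ind] by blast
      moreover have "z \<notin> C m"
        using z' span_base by blast
      ultimately show False
        using n[of m] fin by simp
    qed
  qed
  then show ?thesis by blast
qed

section \<open>Invariants of bounded degree and their common fixed zeros\<close>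

context G_module
begin

lemma subspace_V: "subspace V"
  using finite_dim by auto

text \<open>Separates two tasks: invariance is checked on a convenient formula \<open>h\<close>,
  while a polynomial \<open>f\<close> agreeing with it on \<open>V\<close> witnesses the degree
  bound.\<close>

lemma invariants_leI:
  assumes "f \<in> polys_le (linear_forms smul V) d"
    and "\<And>v. v \<in> V \<Longrightarrow> h v = f v"
    and "\<And>g v. g \<in> carrier G \<Longrightarrow> v \<in> V \<Longrightarrow> h (act g v) = h v"
  shows "restrict h V \<in> invariants_le d"
proof -
  have "restrict h V = restrict f V"
    using assms(2) by (auto simp: restrict_def)
  then have "restrict h V \<in> coord_ring_le d"
    using assms(1) by (auto simp: coord_ring_le_def)
  moreover have "fun_act g (restrict h V) = restrict h V" if "g \<in> carrier G" for g
    using that assms(3) act_closed by (auto simp: fun_act_def restrict_def)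
  ultimately show ?thesis
    by (auto simp: invariants_le_def invariants_def coord_ring_def)
qed

lemma invariants_leE:
  assumes "f \<in> invariants_le d"
  obtains f' where "f' \<in> polys_le (linear_forms smul V) d" "\<And>v. v \<in> V \<Longrightarrow> f v = f' v"
  using assms by (auto simp: invariants_le_def coord_ring_le_def)

lemma invariants_act:
  assumes "f \<in> invariants" "g \<in> carrier G" "v \<in> V"
  shows "f (act g v) = f v"
proof -
  \<comment> \<open>The action on functions inverts its group element, hence the choice of
    \<open>inv g\<close>.\<close>
  have "fun_act (inv g) f v = f v"
    using assms by (simp add: invariants_def)
  then show ?thesis
    using assms by (simp add: fun_act_def)
qed

lemma invariants_scale_act:
  assumes "f \<in> invariants" "g \<in> carrier G" "v \<in> V"
  shows "f (smul c (act g v)) = f (smul c v)"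
  using assms invariants_act[of f g "smul c v"] subspace_scale[OF subspace_V] by (simp add: act_scale)

lemma invariants_le_mono: "d \<le> e \<Longrightarrow> invariants_le d \<subseteq> invariants_le e"
  using polys_le_mono[of d e "linear_forms smul V"]
  by (auto simp: invariants_le_def coord_ring_le_def)

lemma fixed_pointsD: "v \<in> fixed_points \<Longrightarrow> v \<in> V" "v \<in> fixed_points \<Longrightarrow> g \<in> carrier G \<Longrightarrow> act g v = v"
  by (auto simp: fixed_points_def)

lemma subspace_fixed_points: "subspace fixed_points"
  using subspace_V
  by (auto simp: subspace_def fixed_points_def act_add act_scale)
    (metis act_scale scale_zero_left)

text \<open>The \<open>Z d\<close> of the overview. Restricting to fixed vectors makes translation
  by its elements commute with the action.\<close>

definition common_zeros :: "nat \<Rightarrow> 'v set"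
  where "common_zeros d = {v \<in> fixed_points. \<forall>f\<in>plus_part (invariants_le d). f v = 0}"

lemma common_zerosD:
  assumes "v \<in> common_zeros d"
  shows "v \<in> fixed_points" "f \<in> invariants_le d \<Longrightarrow> f 0 = 0 \<Longrightarrow> f v = 0"
  using assms by (auto simp: common_zeros_def plus_part_def)

lemma common_zeros_antimono: "antimono common_zeros"
  using invariants_le_mono unfolding antimono_def common_zeros_def plus_part_def by blast

text \<open>Invariants of degree 0 are constant on \<open>V\<close>; without constant term they
  impose no condition.\<close>

lemma common_zeros_0: "common_zeros 0 = fixed_points"
proof -
  have "f v = 0" if f: "f \<in> invariants_le 0" "f 0 = 0" "v \<in> V" for f v
  proof -
    obtain f' where "f' \<in> polys_le (linear_forms smul V) 0" "\<And>v. v \<in> V \<Longrightarrow> f v = f' v"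
      using invariants_leE[OF f(1)] by blast
    then show ?thesis
      using f polys_le_0D[of f' _ v 0] subspace_0[OF subspace_V] by metis
  qed
  then show ?thesis
    by (auto simp: common_zeros_def plus_part_def fixed_points_def)
qed

lemma delta_set_iff: "delta_set (invariants_le d) \<longleftrightarrow> common_zeros d \<subseteq> nullcone"
  by (auto simp: delta_set_def common_zeros_def invariants_le_def)

text \<open>The difference \<open>?D\<close> loses a degree by \<open>polys_le_shift\<close> and is
  invariant because \<open>w\<close> is fixed. The roles are asymmetric: \<open>w\<close> is the
  parameter of the translation, \<open>v\<close> the point where \<open>?D\<close> is
  evaluated.\<close>

lemma invariants_le_Suc_add:
  assumes f: "f \<in> invariants_le (Suc d)" "f 0 = 0"
    and v: "v \<in> common_zeros d" and w: "w \<in> fixed_points"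
  shows "f (v + w) = f v + f w"
proof -
  have wV: "w \<in> V" and vV: "v \<in> V"
    using v w common_zerosD(1) fixed_pointsD(1) by auto
  obtain f' where f': "f' \<in> polys_le (linear_forms smul V) (Suc d)" "\<And>v. v \<in> V \<Longrightarrow> f v = f' v"
    using invariants_leE[OF f(1)] by blast
  obtain h where h: "h \<in> polys_le (linear_forms smul V) d" "\<And>x. x \<in> V \<Longrightarrow> f' (x + w) = f' x + h x"
    using polys_le_shift[OF f'(1) wV] by blast
  let ?D = "\<lambda>x. f (x + w) - f x - f w"
  have inv: "f \<in> invariants"
    using f(1) by (simp add: invariants_le_def)
  have "restrict ?D V \<in> invariants_le d"
  proof (rule invariants_leI)
    show "(\<lambda>x. h x + (- f w)) \<in> polys_le (linear_forms smul V) d"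
      using h(1) by (intro polys_le_add polys_le_const)
    show "?D x = h x + (- f w)" if "x \<in> V" for x
      using that wV h(2) f'(2) subspace_add[OF subspace_V] by simp
    show "?D (act g x) = ?D x" if "g \<in> carrier G" "x \<in> V" for g x
    proof -
      have "act g x + w = act g (x + w)"
        using that w wV fixed_pointsD(2) by (simp add: act_add)
      then show ?thesis
        using that wV invariants_act[OF inv] subspace_add[OF subspace_V] by simp
    qed
  qed
  moreover have "restrict ?D V 0 = 0"
    using f(2) subspace_0[OF subspace_V] by simp
  ultimately have "restrict ?D V v = 0"
    using common_zerosD(2)[OF v] by blast
  then show ?thesis
    using vV by (simp add: algebra_simps)
qed

text \<open>Scalars commute with the action and dilation does not raise the degree. The case
  \<open>d = 0\<close> stands apart because \<open>polys_le_dilate\<close> speaks of a bound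
  \<open>Suc d\<close>.\<close>

lemma invariants_le_dilate:
  assumes f: "f \<in> invariants_le d"
  shows "restrict (\<lambda>x. f (smul c x)) V \<in> invariants_le d"
proof (cases d)
  case 0
  obtain f' where f': "f' \<in> polys_le (linear_forms smul V) 0" "\<And>v. v \<in> V \<Longrightarrow> f v = f' v"
    using invariants_leE[OF f[unfolded 0]] by blast
  then have "f (smul c x) = f x" if "x \<in> V" for x
    using that subspace_scale[OF subspace_V] polys_le_0D[OF f'(1)] by metis
  then have "restrict (\<lambda>x. f (smul c x)) V = restrict f V"
    by (auto simp: restrict_def)
  also have "\<dots> \<in> invariants_le d"
  proof (rule invariants_leI)
    show "f' \<in> polys_le (linear_forms smul V) d"
      using f'(1) 0 by simp
  qed (use f f'(2) invariants_act[of f] in \<open>simp_all add: invariants_le_def\<close>)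
  finally show ?thesis .
next
  case (Suc e)
  obtain f' where f': "f' \<in> polys_le (linear_forms smul V) (Suc e)" "\<And>v. v \<in> V \<Longrightarrow> f v = f' v"
    using invariants_leE[OF f[unfolded Suc]] by blast
  obtain h where h: "h \<in> polys_le (linear_forms smul V) e"
    "\<And>x. x \<in> V \<Longrightarrow> f' (smul c x) = c ^ Suc e * f' x + h x"
    using polys_le_dilate[OF f'(1)] by blast
  have inv: "f \<in> invariants"
    using f(1) by (simp add: invariants_le_def)
  show ?thesis
  proof (rule invariants_leI)
    show "(\<lambda>x. c ^ Suc e * f' x + h x) \<in> polys_le (linear_forms smul V) d"
      using h(1) f'(1) polys_le_mono[of e d] Suc
      by (intro polys_le_add polys_le_scale) auto
  qed (use h(2) f'(2) invariants_scale_act[OF inv] subspace_scale[OF subspace_V] in simp_all)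
qed

text \<open>The dilation analogue of \<open>invariants_le_Suc_add\<close>: \<open>?D\<close> is an
  invariant of degree at most \<open>d\<close> vanishing at the origin, hence at
  \<open>v\<close>.\<close>

lemma invariants_le_Suc_homogeneous:
  assumes f: "f \<in> invariants_le (Suc d)" "f 0 = 0" and v: "v \<in> common_zeros d"
  shows "f (smul c v) = c ^ Suc d * f v"
proof -
  have vV: "v \<in> V"
    using v common_zerosD(1) fixed_pointsD(1) by auto
  obtain f' where f': "f' \<in> polys_le (linear_forms smul V) (Suc d)" "\<And>v. v \<in> V \<Longrightarrow> f v = f' v"
    using invariants_leE[OF f(1)] by blast
  obtain h where h: "h \<in> polys_le (linear_forms smul V) d"
    "\<And>x. x \<in> V \<Longrightarrow> f' (smul c x) = c ^ Suc d * f' x + h x"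
    using polys_le_dilate[OF f'(1)] by blast
  let ?D = "\<lambda>x. f (smul c x) - c ^ Suc d * f x"
  have inv: "f \<in> invariants"
    using f(1) by (simp add: invariants_le_def)
  have "restrict ?D V \<in> invariants_le d"
  proof (rule invariants_leI[OF h(1)])
    show "?D x = h x" if "x \<in> V" for x
      using that h(2) f'(2) subspace_scale[OF subspace_V] by simp
    show "?D (act g x) = ?D x" if "g \<in> carrier G" "x \<in> V" for g x
      using that inv by (simp add: invariants_act invariants_scale_act)
  qed
  moreover have "restrict ?D V 0 = 0"
    using f(2) subspace_0[OF subspace_V] by simp
  ultimately have "restrict ?D V v = 0"
    using common_zerosD(2)[OF v] by blast
  then show ?thesis
    using vV by simp
qed

text \<open>For \<open>Suc d\<close>, the vectors already lie in \<open>common_zeros d\<close>,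
  where the invariants to be tested are additive.\<close>

lemma subspace_common_zeros: "subspace (common_zeros d)"
proof (induction d)
  case 0
  then show ?case
    by (simp add: common_zeros_0 subspace_fixed_points)
next
  case (Suc d)
  show ?case
  proof (rule subspaceI)
    show "0 \<in> common_zeros (Suc d)"
      using subspace_0[OF subspace_fixed_points] by (auto simp: common_zeros_def plus_part_def)
  next
    fix v w assume v: "v \<in> common_zeros (Suc d)" and w: "w \<in> common_zeros (Suc d)"
    then have vd: "v \<in> common_zeros d"
      using antimonoD[OF common_zeros_antimono, of d "Suc d"] by auto
    have "f (v + w) = 0" if "f \<in> invariants_le (Suc d)" "f 0 = 0" for f
      using invariants_le_Suc_add[OF that vd common_zerosD(1)[OF w]]
        common_zerosD(2)[OF v that] common_zerosD(2)[OF w that] by simp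
    moreover have "v + w \<in> fixed_points"
      using v w common_zerosD(1) subspace_add[OF subspace_fixed_points] by blast
    ultimately show "v + w \<in> common_zeros (Suc d)"
      by (simp add: common_zeros_def plus_part_def)
  next
    fix c v assume v: "v \<in> common_zeros (Suc d)"
    \<comment> \<open>This is the value at \<open>v\<close> of the dilated invariant, which obeys
      the same degree bound.\<close>
    have "f (smul c v) = 0" if "f \<in> invariants_le (Suc d)" "f 0 = 0" for f
      using common_zerosD(2)[OF v invariants_le_dilate[OF that(1), of c]] that(2)
        fixed_pointsD(1)[OF common_zerosD(1)[OF v]] subspace_0[OF subspace_V] by simp
    moreover have "smul c v \<in> fixed_points"
      using v common_zerosD(1) subspace_scale[OF subspace_fixed_points] by blast
    ultimately show "smul c v \<in> common_zeros (Suc d)"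
      by (simp add: common_zeros_def plus_part_def)
  qed
qed

section \<open>Possible values of \<open>delta\<close>\<close>

text \<open>Ensures that \<open>LEAST\<close> is attained: once the chain is stationary, its members
  lie in the nullcone.\<close>

lemma delta_set_delta: "delta_set (invariants_le delta)"
proof -
  obtain B where B: "finite B" "V = span B"
    using finite_dim by blast
  have "common_zeros n \<subseteq> span B" for n
    using B common_zerosD(1) fixed_pointsD(1) by blast
  then obtain n where n: "\<And>m. m \<ge> n \<Longrightarrow> common_zeros m = common_zeros n"
    using descending_subspaces_stabilise[OF B(1) _ subspace_common_zeros common_zeros_antimono]
    by metis
  have "f v = 0" if f: "v \<in> common_zeros n" "f \<in> invariants" "f 0 = 0" for v f
  proof -
    obtain e where "f \<in> invariants_le e"
      using f(2) by (auto simp: invariants_def invariants_le_def coord_ring_def)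
    then have "f \<in> invariants_le (max n e)"
      using invariants_le_mono[of e "max n e"] by auto
    then show ?thesis
      using n[of "max n e"] f(1,3) common_zerosD(2)[of v "max n e" f] by simp
  qed
  then have "delta_set (invariants_le n)"
    using common_zerosD(1) fixed_pointsD(1)
    by (fastforce simp: delta_set_iff nullcone_def plus_part_def)
  then show ?thesis
    unfolding delta_def by (rule LeastI)
qed

lemma delta_cases: "delta = 0 \<or> delta = 1 \<or> CHAR('k) dvd delta"
proof (rule disjCI)
  assume small: "\<not> (delta = 1 \<or> CHAR('k) dvd delta)"
  show "delta = 0"
  proof (rule ccontr)
    assume "delta \<noteq> 0"
    then obtain d where d: "delta = Suc d"
      using not0_implies_Suc by blast
    then have "\<not> delta_set (invariants_le d)"
      using not_less_Least[of d "\<lambda>d. delta_set (invariants_le d)"] by (simp add: delta_def)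
    then obtain v where v: "v \<in> common_zeros d" "v \<notin> nullcone"
      by (auto simp: delta_set_iff)
    then have "v \<in> fixed_points - nullcone"
      using common_zerosD(1) by blast
    then obtain f where f: "f \<in> invariants_le (Suc d)" "f 0 = 0" "f v \<noteq> 0"
      using delta_set_delta d unfolding delta_set_def plus_part_def by auto
    \<comment> \<open>Evaluates \<open>f\<close> at \<open>(1 + t) v\<close> twice, by homogeneity
      and by additivity along the line through \<open>v\<close>, and cancels
      \<open>f v\<close>.\<close>
    have "(1 + t) ^ Suc d = 1 + t ^ Suc d" for t :: 'k
    proof -
      have "smul t v \<in> fixed_points"
        using common_zerosD(1)[OF v(1)] by (rule subspace_scale[OF subspace_fixed_points])
      then have "f (v + smul t v) = f v + f (smul t v)"
        by (rule invariants_le_Suc_add[OF f(1,2) v(1)])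
      moreover have "v + smul t v = smul (1 + t) v"
        by (simp add: scale_left_distrib)
      ultimately have "(1 + t) ^ Suc d * f v = (1 + t ^ Suc d) * f v"
        unfolding distrib_right using invariants_le_Suc_homogeneous[OF f(1,2) v(1)] by simp
      then show ?thesis
        using f(3) by simp
    qed
    \<comment> \<open>Here \<open>small\<close> excludes \<open>delta = 1\<close>, which gives the
      required \<open>Suc d \<ge> 2\<close>.\<close>
    then have "CHAR('k) dvd Suc d"
      using CHAR_dvd_if_additive_power[of "Suc d"] small d by force
    then show False
      using small d by simp
  qed
qed

end

section \<open>Trivial modules and the lower bound for \<open>delta_group\<close>\<close>

lemma trivial_G_module:
  fixes G :: "('k::alg_closed_field ^ 'm) monoid"
    and smul :: "'k \<Rightarrow> 'v::ab_group_add \<Rightarrow> 'v"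
  assumes "linear_algebraic_group G" "vector_space smul" "finite B"
  shows "G_module G smul (module.span smul B) (\<lambda>_ v. v)"
proof -
  interpret linear_algebraic_group G by fact
  interpret vector_space smul by fact
  show ?thesis
  proof
    show "regular_on (carrier G) (\<lambda>g. l v)" for l :: "'v \<Rightarrow> 'k" and v
      using polys_le_const by (force simp: regular_on_def polys_def)
  qed (use assms(3) in auto)
qed

text \<open>Every vector is fixed and \<open>l\<close> is itself an invariant of degree 1, so
  \<open>v\<close> lies outside the nullcone, while degree 0 detects nothing.\<close>

lemma trivial_G_module_delta_pos:
  fixes G :: "('k::alg_closed_field ^ 'm) monoid"
  assumes "G_module G smul V (\<lambda>_ v. v)" "l \<in> linear_forms smul V" "v \<in> V" "l v \<noteq> 0"
  shows "G_module.delta G smul V (\<lambda>_ v. v) \<noteq> 0"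
proof
  interpret G_module G smul V "\<lambda>_ v. v" by fact
  assume "delta = 0"
  then have "common_zeros 0 \<subseteq> nullcone"
    using delta_set_delta delta_set_iff by simp
  moreover have "v \<in> common_zeros 0"
    using assms(3) by (simp add: common_zeros_0 fixed_points_def)
  moreover have "restrict l V \<in> invariants_le 1"
    using polys_le_prod[of "[l]" "linear_forms smul V" 1] assms(2)
    by (intro invariants_leI[of l]) auto
  moreover have "restrict l V 0 = 0"
  proof -
    have "l (smul 0 v) = 0 * l v"
      using assms(2,3) by (simp only: linear_forms_def mem_Collect_eq)
    then show ?thesis
      using subspace_0[OF subspace_V] by simp
  qed
  ultimately have "restrict l V v = 0"
    unfolding nullcone_def plus_part_def invariants_le_def by blast
  then show False
    using assms(3,4) by simp
qed

theorem corollary2p2: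
  fixes G :: "('k::alg_closed_field ^ 'm) monoid"
  assumes "linear_algebraic_group G"
  shows "(\<forall>(smul :: 'k \<Rightarrow> 'v::ab_group_add \<Rightarrow> 'v) V act. G_module G smul V act \<longrightarrow>
            G_module.delta G smul V act = 0 \<or> G_module.delta G smul V act = 1 \<or>
            CHAR('k) dvd G_module.delta G smul V act)
         \<and> (CHAR('k) = 0 \<longrightarrow> delta_group G = 1)"
proof (intro conjI impI)
  show "\<forall>(smul :: 'k \<Rightarrow> 'v::ab_group_add \<Rightarrow> 'v) V act. G_module G smul V act \<longrightarrow>
            G_module.delta G smul V act = 0 \<or> G_module.delta G smul V act = 1 \<or>
            CHAR('k) dvd G_module.delta G smul V act"
    using G_module.delta_cases by blast
  assume char: "CHAR('k) = 0"
  let ?D = "{enat (G_module.delta G fun_scale V act) | (V :: (nat \<Rightarrow> 'k) set) act.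
           G_module G fun_scale V act}"
  \<comment> \<open>Divisibility by \<open>CHAR('k) = 0\<close> forces
    \<open>delta = 0\<close>.\<close>
  have le: "G_module.delta G fun_scale V act \<le> 1" if "G_module G fun_scale V act"
    for V :: "(nat \<Rightarrow> 'k) set" and act
    using G_module.delta_cases[OF that] char by auto
  \<comment> \<open>A line with trivial action attains the bound 1; evaluation at index 0 is a form
    that is nonzero on its generator.\<close>
  let ?V = "fun_space.span {\<lambda>_. 1} :: (nat \<Rightarrow> 'k) set"
  have V: "G_module G fun_scale ?V (\<lambda>_ v. v)"
    using trivial_G_module[OF assms fun_space.vector_space_axioms, of "{\<lambda>_. 1}"] by simp
  have "(\<lambda>v. v 0) \<in> linear_forms fun_scale ?V"
    by (simp add: linear_forms_def fun_scale_def)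
  then have "G_module.delta G fun_scale ?V (\<lambda>_ v. v) \<noteq> 0"
    by (rule trivial_G_module_delta_pos[OF V, where v = "\<lambda>_. 1"])
      (auto intro: fun_space.span_base)
  then have "G_module.delta G fun_scale ?V (\<lambda>_ v. v) = 1"
    using le[OF V] by simp
  moreover have "enat (G_module.delta G fun_scale ?V (\<lambda>_ v. v)) \<in> ?D"
    using V by blast
  ultimately have "1 \<in> ?D"
    by (simp only: one_enat_def)
  moreover have "x \<le> 1" if "x \<in> ?D" for x
    using that le by (auto simp: one_enat_def)
  ultimately show "delta_group G = 1"
    unfolding delta_group_def by (intro antisym Sup_least Sup_upper)
qed

end
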